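(* Let $\{X_1,X_2,\dots\}$ be pairwise uncorrelated random variables satisfying $\sum_{n=1}^{\infty}\mathrm{Var}(X_n)<\infty$. Then for any $1<q\leq 2$, $$\sum_{n=1}^{\infty}E\left[\left|\frac{S_n-E(S_n)}{n}\right|^q\right]<\infty ;$$ in particular, $\frac{S_n-E(S_n)}{n}$ converges completely to $0$.
   Context: All random variables are real-valued and defined on a common probability space $(\Omega,\mathcal{F},P)$; $E$ denotes expectation and $\mathrm{Var}$ denotes variance (the $X_n$ have finite second moments, so that variances and covariances are defined and finite). $S_n=\sum_{k=1}^n X_k$ for $n\ge 1$. Pairwise uncorrelated means $\mathrm{Cov}(X_i,X_j)=0$ for all $i\neq j$. A sequence of random variables $\{Y_n,n\ge1\}$ is said to converge completely to a random variable $Y$ if for every $\varepsilon>0$, $\sum_{n=1}^{\infty}P\{|Y_n-Y|\geq\varepsilon\}<\infty$. *)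

theory Defs
  imports "HOL-Probability.Probability"
begin

definition covariance :: "'a measure \<Rightarrow> ('a \<Rightarrow> real) \<Rightarrow> ('a \<Rightarrow> real) \<Rightarrow> real" where
  "covariance M X Y =
     prob_space.expectation M
       (\<lambda>\<omega>. (X \<omega> - prob_space.expectation M X) * (Y \<omega> - prob_space.expectation M Y))"

(* Sequences are indexed by n >= 1: index 0 of a function on nat is never used. *)

definition pairwise_uncorrelated :: "'a measure \<Rightarrow> (nat \<Rightarrow> 'a \<Rightarrow> real) \<Rightarrow> bool" where
  "pairwise_uncorrelated M X \<longleftrightarrow> pairwise (\<lambda>i j. covariance M (X i) (X j) = 0) {1..}"

definition partial_sum :: "(nat \<Rightarrow> 'a \<Rightarrow> real) \<Rightarrow> nat \<Rightarrow> 'a \<Rightarrow> real" where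
  "partial_sum X n \<omega> = (\<Sum>k=1..n. X k \<omega>)"

definition centered_average :: "'a measure \<Rightarrow> (nat \<Rightarrow> 'a \<Rightarrow> real) \<Rightarrow> nat \<Rightarrow> 'a \<Rightarrow> real" where
  "centered_average M X n \<omega> =
     (partial_sum X n \<omega> - prob_space.expectation M (partial_sum X n)) / real n"

(* Intended for measurable Y n and Z; a sum over n >= 1 is a sum over Suc n. *)
definition converges_completely ::
    "'a measure \<Rightarrow> (nat \<Rightarrow> 'a \<Rightarrow> real) \<Rightarrow> ('a \<Rightarrow> real) \<Rightarrow> bool" where
  "converges_completely M Y Z \<longleftrightarrow>
     (\<forall>\<epsilon>>0. summable (\<lambda>n. measure M {\<omega> \<in> space M. \<bar>Y (Suc n) \<omega> - Z \<omega>\<bar> \<ge> \<epsilon>}))"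

end

theory Submission
  imports Defs
begin

text \<open>
  Let \<open>T n\<close> be the centered sum. Orthogonality bounds \<open>E (T n)\<^sup>2\<close> by the sum \<open>V\<close> of all variances.
  For \<open>0 < q \<le> 2\<close> one has \<open>\<bar>t\<bar> powr q \<le> 1 + t\<^sup>2\<close>; applying this to \<open>T n\<close> before dividing by
  \<open>n powr q\<close> gives the bound \<open>(1 + V) / n powr q\<close> for the \<open>q\<close>-th moment, without any moment
  inequality. Complete convergence is Chebyshev's inequality together with the case \<open>q = 2\<close>.
\<close>

text \<open>Split at \<open>\<bar>t\<bar> = 1\<close>: up to there the power is at most 1, and
  beyond it the power grows with the exponent, so exponent 2 dominates.\<close>

lemma abs_powr_le_one_plus_square:
  fixes t q :: real
  assumes "0 < q" "q \<le> 2"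
  shows "\<bar>t\<bar> powr q \<le> 1 + t\<^sup>2"
proof (cases "\<bar>t\<bar> \<le> 1")
  case True
  then have "\<bar>t\<bar> powr q \<le> 1 powr q"
    using assms by (intro powr_mono2) auto
  then show ?thesis
    by (simp add: add_increasing2)
next
  case False
  then have "\<bar>t\<bar> powr q \<le> \<bar>t\<bar> powr 2"
    using assms by (intro powr_mono) auto
  then show ?thesis
    using False by simp
qed

text \<open>The product is dominated by the sum of the squares. This makes the cross terms
  integrable when the square of a sum is expanded.\<close>

lemma integrable_mult_of_squares:
  fixes f g :: "'a \<Rightarrow> real"
  assumes [measurable]: "f \<in> borel_measurable M" "g \<in> borel_measurable M"
    and "integrable M (\<lambda>x. (f x)\<^sup>2)" "integrable M (\<lambda>x. (g x)\<^sup>2)"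
  shows "integrable M (\<lambda>x. f x * g x)"
proof (rule Bochner_Integration.integrable_bound)
  show "integrable M (\<lambda>x. (f x)\<^sup>2 + (g x)\<^sup>2)"
    using assms by simp
  \<comment> \<open>The known bound is \<open>2 * \<bar>a\<bar> * \<bar>b\<bar> \<le> a\<^sup>2 +
    b\<^sup>2\<close>; nonnegativity of \<open>\<bar>a * b\<bar>\<close> allows dropping the factor
    2.\<close>
  have "\<bar>a * b\<bar> \<le> a\<^sup>2 + b\<^sup>2" for a b :: real
    using sum_squares_bound[of "\<bar>a\<bar>" "\<bar>b\<bar>"] abs_ge_zero[of "a * b"]
    unfolding abs_mult power2_abs by linarith
  then show "AE x in M. norm (f x * g x) \<le> norm ((f x)\<^sup>2 + (g x)\<^sup>2)"
    by simp
qed simp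

text \<open>Pythagoras in L2: after expanding the square into a double sum, orthogonality leaves
  only the diagonal.\<close>

lemma integral_sum_square_orthogonal:
  fixes Y :: "'i \<Rightarrow> 'a \<Rightarrow> real"
  assumes "finite I"
    and "\<And>i. i \<in> I \<Longrightarrow> Y i \<in> borel_measurable M"
    and "\<And>i. i \<in> I \<Longrightarrow> integrable M (\<lambda>x. (Y i x)\<^sup>2)"
    and orth: "pairwise (\<lambda>i j. (\<integral>x. Y i x * Y j x \<partial>M) = 0) I"
  shows "integrable M (\<lambda>x. (\<Sum>i\<in>I. Y i x)\<^sup>2)"
    and "(\<integral>x. (\<Sum>i\<in>I. Y i x)\<^sup>2 \<partial>M) = (\<Sum>i\<in>I. \<integral>x. (Y i x)\<^sup>2 \<partial>M)"
proof -
  have int: "integrable M (\<lambda>x. Y i x * Y j x)" if "i \<in> I" "j \<in> I" for i j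
    using that assms by (intro integrable_mult_of_squares) auto
  have expand: "(\<Sum>i\<in>I. Y i x)\<^sup>2 = (\<Sum>i\<in>I. \<Sum>j\<in>I. Y i x * Y j x)" for x
    by (simp add: power2_eq_square sum_product)
  show "integrable M (\<lambda>x. (\<Sum>i\<in>I. Y i x)\<^sup>2)"
    unfolding expand using int by (intro Bochner_Integration.integrable_sum) auto
  have "(\<integral>x. (\<Sum>i\<in>I. Y i x)\<^sup>2 \<partial>M) = (\<Sum>i\<in>I. \<Sum>j\<in>I. \<integral>x. Y i x * Y j x \<partial>M)"
    unfolding expand using int
    by (simp add: Bochner_Integration.integral_sum Bochner_Integration.integrable_sum)
  also have "\<dots> = (\<Sum>i\<in>I. \<Sum>j\<in>I. if j = i then \<integral>x. (Y i x)\<^sup>2 \<partial>M else 0)"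
    using orth by (intro sum.cong refl) (auto simp: pairwise_def power2_eq_square)
  also have "\<dots> = (\<Sum>i\<in>I. \<integral>x. (Y i x)\<^sup>2 \<partial>M)"
    using assms(1) by simp
  finally show "(\<integral>x. (\<Sum>i\<in>I. Y i x)\<^sup>2 \<partial>M) = (\<Sum>i\<in>I. \<integral>x. (Y i x)\<^sup>2 \<partial>M)" .
qed

text \<open>The p-series behind the moment bound; this is where \<open>1 < q\<close> enters.\<close>

lemma summable_Suc_powr:
  fixes q :: real
  assumes "1 < q"
  shows "summable (\<lambda>n. C / real (Suc n) powr q)"
proof -
  have "summable (\<lambda>n. real (Suc n) powr - q)"
    using assms by (subst summable_Suc_iff) (simp add: summable_real_powr_iff)
  then have "summable (\<lambda>n. C * real (Suc n) powr - q)"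
    by (rule summable_mult)
  then show ?thesis
    by (simp only: powr_minus divide_inverse)
qed

context prob_space
begin

text \<open>The factor \<open>c powr q\<close> is pulled out before the pointwise bound is applied.
  Bounding the power of \<open>T x / c\<close> directly would leave a constant 1 that does not decay
  in \<open>c\<close>.\<close>

lemma moment_scaled_le:
  fixes T :: "'a \<Rightarrow> real" and c q :: real
  assumes [measurable]: "T \<in> borel_measurable M" and T2: "integrable M (\<lambda>x. (T x)\<^sup>2)"
    and "0 < q" "q \<le> 2" "0 < c"
  shows "integrable M (\<lambda>x. \<bar>T x / c\<bar> powr q)"
    and "expectation (\<lambda>x. \<bar>T x / c\<bar> powr q) \<le> (1 + expectation (\<lambda>x. (T x)\<^sup>2)) / c powr q"
proof -
  have eq: "\<bar>T x / c\<bar> powr q = \<bar>T x\<bar> powr q / c powr q" for x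
    using \<open>0 < c\<close> by (simp add: powr_divide)
  have le: "\<bar>T x\<bar> powr q \<le> 1 + (T x)\<^sup>2" for x
    using assms by (intro abs_powr_le_one_plus_square)
  have bound: "integrable M (\<lambda>x. 1 + (T x)\<^sup>2)"
    using T2 by simp
  have int: "integrable M (\<lambda>x. \<bar>T x\<bar> powr q)"
    using le by (intro Bochner_Integration.integrable_bound[OF bound]) auto
  then show "integrable M (\<lambda>x. \<bar>T x / c\<bar> powr q)"
    unfolding eq by simp
  have "expectation (\<lambda>x. \<bar>T x\<bar> powr q) \<le> expectation (\<lambda>x. 1 + (T x)\<^sup>2)"
    using int bound le by (intro integral_mono)
  also have "\<dots> = 1 + expectation (\<lambda>x. (T x)\<^sup>2)"
    using T2 by (simp add: prob_space)
  finally show "expectation (\<lambda>x. \<bar>T x / c\<bar> powr q) \<le> (1 + expectation (\<lambda>x. (T x)\<^sup>2)) / c powr q"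
    unfolding eq by (simp add: divide_right_mono)
qed

text \<open>Chebyshev bounds each tail probability by the second moment over
  \<open>\<epsilon>\<^sup>2\<close>, and the comparison test finishes.\<close>

lemma converges_completely_0_if_summable_second_moments:
  assumes meas: "\<And>n. Z (Suc n) \<in> borel_measurable M"
    and int: "\<And>n. integrable M (\<lambda>x. (Z (Suc n) x)\<^sup>2)"
    and sm: "summable (\<lambda>n. expectation (\<lambda>x. (Z (Suc n) x)\<^sup>2))"
  shows "converges_completely M Z (\<lambda>x. 0)"
  unfolding converges_completely_def
proof (intro allI impI)
  fix \<epsilon> :: real
  assume "\<epsilon> > 0"
  have "prob {x \<in> space M. \<bar>Z (Suc n) x - 0\<bar> \<ge> \<epsilon>} \<le> expectation (\<lambda>x. (Z (Suc n) x)\<^sup>2) / \<epsilon>\<^sup>2" for n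
    using second_moment_method[OF meas int \<open>\<epsilon> > 0\<close>, of n] by simp
  then show "summable (\<lambda>n. prob {x \<in> space M. \<bar>Z (Suc n) x - 0\<bar> \<ge> \<epsilon>})"
    by (intro summable_comparison_test'[OF summable_divide[OF sm], where N = 0]) simp
qed

end

theorem proposition3p6:
  fixes M :: "'a measure" and X :: "nat \<Rightarrow> 'a \<Rightarrow> real"
  assumes "prob_space M"
    and "\<And>n. n \<ge> 1 \<Longrightarrow> X n \<in> borel_measurable M"
    and "\<And>n. n \<ge> 1 \<Longrightarrow> integrable M (\<lambda>\<omega>. (X n \<omega>)\<^sup>2)"
    and "pairwise_uncorrelated M X"
    and "summable (\<lambda>n. prob_space.variance M (X (Suc n)))"
  shows "(\<forall>q::real. 1 < q \<and> q \<le> 2 \<longrightarrow>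
            (\<forall>n\<ge>1. integrable M (\<lambda>\<omega>. \<bar>centered_average M X n \<omega>\<bar> powr q)) \<and>
            summable (\<lambda>n. prob_space.expectation M
                            (\<lambda>\<omega>. \<bar>centered_average M X (Suc n) \<omega>\<bar> powr q)))
       \<and> converges_completely M (centered_average M X) (\<lambda>\<omega>. 0)"
proof -
  interpret prob_space M by fact
  \<comment> \<open>With this centering, covariances and variances of \<open>X\<close> are literally
    the integrals of products and squares of \<open>Y\<close>.\<close>
  define Y where "Y k x = X k x - expectation (X k)" for k x
  define T where "T n x = (\<Sum>k=1..n. Y k x)" for n x
  define V where "V = (\<Sum>k. variance (X (Suc k)))"
  have X_int: "integrable M (X k)" if "k \<ge> 1" for k
    using assms(2,3)[OF that] by (rule square_integrable_imp_integrable)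
  have Y_meas: "Y k \<in> borel_measurable M" if "k \<ge> 1" for k
    using assms(2)[OF that] unfolding Y_def by measurable
  \<comment> \<open>Expanding the square leaves a term linear in \<open>X k\<close>, integrable
    because square integrability implies integrability on a probability space.\<close>
  have Y_sq: "integrable M (\<lambda>x. (Y k x)\<^sup>2)" if "k \<ge> 1" for k
    unfolding Y_def power2_diff using X_int[OF that] assms(3)[OF that] by simp
  have T_meas [measurable]: "T n \<in> borel_measurable M" for n
    unfolding T_def using Y_meas by (intro borel_measurable_sum) auto
  have orth: "pairwise (\<lambda>i j. (\<integral>x. Y i x * Y j x \<partial>M) = 0) {1..n}" for n
    using assms(4) unfolding pairwise_uncorrelated_def covariance_def Y_def
    by (rule pairwise_subset) auto
  have Y_fin: "finite {1..n}" "\<And>k. k \<in> {1..n} \<Longrightarrow> Y k \<in> borel_measurable M"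
    "\<And>k. k \<in> {1..n} \<Longrightarrow> integrable M (\<lambda>x. (Y k x)\<^sup>2)" for n
    using Y_meas Y_sq by auto
  note T_second_moment = integral_sum_square_orthogonal[OF Y_fin orth, folded T_def]
  have T_sq: "integrable M (\<lambda>x. (T n x)\<^sup>2)" for n
    by (rule T_second_moment(1))
  have T_var: "expectation (\<lambda>x. (T n x)\<^sup>2) = (\<Sum>k=1..n. variance (X k))" for n
    using T_second_moment(2) unfolding Y_def .
  have T_le: "expectation (\<lambda>x. (T n x)\<^sup>2) \<le> V" for n
  proof -
    \<comment> \<open>Shifting the index turns the sum over \<open>{1..n}\<close> into a partial sum
      of the series \<open>V\<close>, whose terms are nonnegative.\<close>
    have "expectation (\<lambda>x. (T n x)\<^sup>2) = (\<Sum>k<n. variance (X (Suc k)))"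
      unfolding T_var by (rule sum.reindex_bij_witness[of _ Suc "\<lambda>k. k - 1"]) auto
    also have "\<dots> \<le> V"
      unfolding V_def by (intro sum_le_suminf assms(5)) auto
    finally show ?thesis .
  qed
  \<comment> \<open>By linearity, the centered partial sum is the sum of the centered
    variables.\<close>
  have avg: "centered_average M X n = (\<lambda>x. T n x / real n)" for n
  proof
    fix x
    have "expectation (partial_sum X n) = (\<Sum>k=1..n. expectation (X k))"
      unfolding partial_sum_def using X_int by (intro Bochner_Integration.integral_sum) auto
    then show "centered_average M X n x = T n x / real n"
      by (simp add: centered_average_def T_def Y_def partial_sum_def sum_subtractf)
  qed
  have moments: "integrable M (\<lambda>x. \<bar>T n x / real n\<bar> powr q)"
    "expectation (\<lambda>x. \<bar>T n x / real n\<bar> powr q) \<le> (1 + V) / real n powr q"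
    if "1 < q" "q \<le> 2" "n \<ge> 1" for q n
  proof -
    \<comment> \<open>The scale is \<open>c = real n\<close>, positive because
      \<open>n \<ge> 1\<close>.\<close>
    note * = moment_scaled_le[OF T_meas T_sq, of q "real n" n]
    show "integrable M (\<lambda>x. \<bar>T n x / real n\<bar> powr q)"
      using *(1) that by simp
    have "expectation (\<lambda>x. \<bar>T n x / real n\<bar> powr q)
        \<le> (1 + expectation (\<lambda>x. (T n x)\<^sup>2)) / real n powr q"
      using *(2) that by simp
    also have "\<dots> \<le> (1 + V) / real n powr q"
      using T_le by (intro divide_right_mono) auto
    finally show "expectation (\<lambda>x. \<bar>T n x / real n\<bar> powr q) \<le> (1 + V) / real n powr q" .
  qed
  have sm: "summable (\<lambda>n. expectation (\<lambda>x. \<bar>T (Suc n) x / real (Suc n)\<bar> powr q))"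
    if "1 < q" "q \<le> 2" for q
  proof (rule summable_comparison_test'[OF summable_Suc_powr[OF \<open>1 < q\<close>]])
    \<comment> \<open>The moment is nonnegative, so the norm disappears and the bound from
      \<open>moments\<close> applies.\<close>
    show "norm (expectation (\<lambda>x. \<bar>T (Suc n) x / real (Suc n)\<bar> powr q))
        \<le> (1 + V) / real (Suc n) powr q" for n
      using moments(2)[OF that, of "Suc n"] by (simp add: integral_nonneg_AE)
  qed
  have "converges_completely M (centered_average M X) (\<lambda>x. 0)"
  proof (rule converges_completely_0_if_summable_second_moments)
    show "centered_average M X (Suc n) \<in> borel_measurable M" for n
      unfolding avg by measurable
    show "integrable M (\<lambda>x. (centered_average M X (Suc n) x)\<^sup>2)" for n
      unfolding avg power_divide using T_sq by simp
    show "summable (\<lambda>n. expectation (\<lambda>x. (centered_average M X (Suc n) x)\<^sup>2))"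
      \<comment> \<open>For \<open>q = 2\<close> the absolute moment is the second moment that
        Chebyshev needs.\<close>
      using sm[of 2] unfolding avg by (simp add: power_divide del: of_nat_Suc)
  qed
  then show ?thesis
    using moments(1) sm by (simp add: avg del: of_nat_Suc)
qed

end
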